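(* Let $p,q$ be positive integers and let $\vec u=(u_1,\dots,u_p)$, $\vec v=(v_1,\dots,v_q)$ be vectors whose components are positive integers or $\infty$. Let $R_{\vec u,\vec v}$ be the set of Rota-Baxter words with $p$ operators $P_1,\dots,P_p$ having exponent vector $\vec u$ and $q$ generators $x_1,\dots,x_q$ having exponent vector $\vec v$. Let $r_{\vec u,\vec v}(n,m)$ be the number of words in $R_{\vec u,\vec v}$ of degree $n$ and arity $m$, and let $\mathbf R_{\vec u,\vec v}(z,t)=\sum_{n=0}^\infty\sum_{m=0}^\infty r_{\vec u,\vec v}(n,m)z^nt^m$. Let $\mathbf C_{p,\vec u}(z)=\sum_{a\ge1}c(a,p,\vec u)z^a$ and $\mathbf C_{q,\vec v}(t)=\sum_{b\ge 1}c(b,q,\vec v)t^b$. Then, as formal power series, $$\mathbf R_{\vec u,\vec v}(z,t)=\mathbf R_{1,1}\big(\mathbf C_{p,\vec u}(z),\,\mathbf C_{q,\vec v}(t)\big),$$ where $\mathbf R_{1,1}(z,t)$ is the series for $p=q=1$, $\vec u=(1)$, $\vec v=(1)$.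
   Context: A Rota-Baxter word in generators $x_1,\dots,x_q$ and operators $P_i=\lfloor_i\ \rfloor_i$ ($1\le i\le p$) is either the empty word $\emptyset$ (of degree $0$ and arity $0$) or a nonempty finite string over the symbols $x_1,\dots,x_q,\lfloor_1,\rfloor_1,\dots,\lfloor_p,\rfloor_p$ such that the brackets are balanced (properly nested, each $\lfloor_i$ matched with a $\rfloor_i$ of the same subscript), no right bracket is immediately followed by a left bracket, and no left bracket is immediately followed by a right bracket. The degree of a word is its total number of matched pairs of brackets (all subscripts); its arity is its total number of generator symbols (all subscripts), counted with multiplicity. An $x_j$-run is a maximal block of consecutive symbols $x_j$. A $P_i$-run is a maximal chain of immediately nested matched pairs all of subscript $i$ (a pair is immediately nested in another if the content of the outer pair is exactly the inner pair together with its content); its length is the number of pairs in the chain. Saying that the operators have exponent vector $\vec u$ and the generators have exponent vector $\vec v$ means that $R_{\vec u,\vec v}$ consists of exactly those Rota-Baxter words in which, for all $i$, every $P_i$-run has length $\le u_i$ and, for all $j$, every $x_j$-run has length $\le v_j$. For positive integers $b,q$ and a vector $\vec v=(v_1,\dots,v_q)$ with entries positive integers or $\infty$, $c(b,q,\vec v)$ denotes the number of colorings of $b$ identical objects in a row using colors from $\{1,\dots,q\}$ (repetitions allowed, not all colors need be used) such that for each $j$, every run (maximal block of consecutive objects of the same color) of color $j$ has length at most $v_j$. *)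

theory Defs
  imports "HOL-Library.Extended_Nat" "HOL-Computational_Algebra.Formal_Power_Series"
begin

unbundle fps_syntax

section \<open>Runs in a list\<close>

text \<open>The maximal block of consecutive entries equal to \<open>a\<close> which starts at
  position \<open>s\<close> (counted from 0) and has length \<open>l\<close>.\<close>

definition is_run :: "'a \<Rightarrow> 'a list \<Rightarrow> nat \<Rightarrow> nat \<Rightarrow> bool" where
  "is_run a xs s l \<longleftrightarrow>
     l \<ge> 1 \<and> s + l \<le> length xs \<and> (\<forall>k\<in>{s..<s + l}. xs ! k = a) \<and>
     (s = 0 \<or> xs ! (s - 1) \<noteq> a) \<and> (s + l = length xs \<or> xs ! (s + l) \<noteq> a)"

section \<open>Rota-Baxter words\<close>

datatype rb_symbol =
    is_gen: Gen nat
  | is_left: LBr nat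
  | is_right: RBr nat

inductive balanced :: "rb_symbol list \<Rightarrow> bool" where
  balanced_empty: "balanced []"
| balanced_gen: "balanced [Gen j]"
| balanced_bracket: "balanced w \<Longrightarrow> balanced (LBr i # w @ [RBr i])"
| balanced_append: "balanced w \<Longrightarrow> balanced w' \<Longrightarrow> balanced (w @ w')"

text \<open>Generators and operators are numbered from 1, as \<open>x\<^sub>1, \<dots>, x\<^sub>q\<close> and
  \<open>P\<^sub>1, \<dots>, P\<^sub>p\<close>.\<close>

definition rb_word :: "nat \<Rightarrow> nat \<Rightarrow> rb_symbol list \<Rightarrow> bool" where
  "rb_word p q w \<longleftrightarrow>
     set w \<subseteq> Gen ` {1..q} \<union> LBr ` {1..p} \<union> RBr ` {1..p} \<and>
     balanced w \<and>
     (\<forall>k. Suc k < length w \<longrightarrow> \<not> (is_right (w ! k) \<and> is_left (w ! Suc k))) \<and>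
     (\<forall>k. Suc k < length w \<longrightarrow> \<not> (is_left (w ! k) \<and> is_right (w ! Suc k)))"

text \<open>The left bracket at position \<open>k\<close> and the right bracket at position \<open>l\<close> form a
  matched pair of subscript \<open>i\<close>: the content strictly between them is balanced.\<close>

definition matched_pair :: "rb_symbol list \<Rightarrow> nat \<Rightarrow> nat \<Rightarrow> nat \<Rightarrow> bool" where
  "matched_pair w i k l \<longleftrightarrow>
     k < l \<and> l < length w \<and> w ! k = LBr i \<and> w ! l = RBr i \<and>
     balanced (take (l - Suc k) (drop (Suc k) w))"

definition degree :: "rb_symbol list \<Rightarrow> nat" where
  "degree w = card {(k, l). \<exists>i. matched_pair w i k l}"

definition arity :: "rb_symbol list \<Rightarrow> nat" where
  "arity w = length (filter is_gen w)"

text \<open>A pair at positions \<open>(k', l')\<close> is immediately nested in the pair at \<open>(k, l)\<close> iff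
  \<open>k' = k + 1\<close> and \<open>l' = l - 1\<close>.  So the chain of \<open>n\<close> pairs with outermost pair
  \<open>(k, l)\<close> consists of the pairs \<open>(k + d, l - d)\<close> with \<open>d < n\<close>; it is maximal iff it
  extends neither inwards nor outwards.  The natural number subtractions never
  truncate here, as \<open>k + d < l - d\<close> for \<open>d < n\<close>.\<close>

definition is_operator_run :: "nat \<Rightarrow> rb_symbol list \<Rightarrow> nat \<Rightarrow> nat \<Rightarrow> nat \<Rightarrow> bool" where
  "is_operator_run i w k l n \<longleftrightarrow>
     n \<ge> 1 \<and> (\<forall>d<n. matched_pair w i (k + d) (l - d)) \<and>
     \<not> matched_pair w i (k + n) (l - n) \<and>
     (k = 0 \<or> \<not> matched_pair w i (k - 1) (l + 1))"

text \<open>Exponent vectors are functions of the subscript, of which only the values at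
  \<open>1, \<dots>, p\<close> (resp. \<open>1, \<dots>, q\<close>) matter.\<close>

definition rb_words :: "nat \<Rightarrow> nat \<Rightarrow> (nat \<Rightarrow> enat) \<Rightarrow> (nat \<Rightarrow> enat) \<Rightarrow> rb_symbol list set" where
  "rb_words p q u v =
     {w. rb_word p q w \<and>
         (\<forall>i\<in>{1..p}. \<forall>k l n. is_operator_run i w k l n \<longrightarrow> enat n \<le> u i) \<and>
         (\<forall>j\<in>{1..q}. \<forall>s l. is_run (Gen j) w s l \<longrightarrow> enat l \<le> v j)}"

definition rb_count ::
    "nat \<Rightarrow> nat \<Rightarrow> (nat \<Rightarrow> enat) \<Rightarrow> (nat \<Rightarrow> enat) \<Rightarrow> nat \<Rightarrow> nat \<Rightarrow> nat" where
  "rb_count p q u v n m = card {w \<in> rb_words p q u v. degree w = n \<and> arity w = m}"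

section \<open>Colorings\<close>

definition colorings :: "nat \<Rightarrow> nat \<Rightarrow> (nat \<Rightarrow> enat) \<Rightarrow> nat list set" where
  "colorings b q v =
     {c. length c = b \<and> set c \<subseteq> {1..q} \<and>
         (\<forall>j\<in>{1..q}. \<forall>s l. is_run j c s l \<longrightarrow> enat l \<le> v j)}"

definition coloring_count :: "nat \<Rightarrow> nat \<Rightarrow> (nat \<Rightarrow> enat) \<Rightarrow> nat" where
  "coloring_count b q v = card (colorings b q v)"

section \<open>Generating functions\<close>

text \<open>A power series \<open>F(z, t)\<close> is represented by a power series in \<open>z\<close> whose coefficients
  are power series in \<open>t\<close>, so that \<open>F $ n $ m\<close> is the coefficient of \<open>z\<^sup>n t\<^sup>m\<close>.\<close>

definition rb_gf :: "nat \<Rightarrow> nat \<Rightarrow> (nat \<Rightarrow> enat) \<Rightarrow> (nat \<Rightarrow> enat) \<Rightarrow> int fps fps" where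
  "rb_gf p q u v = Abs_fps (\<lambda>n. Abs_fps (\<lambda>m. int (rb_count p q u v n m)))"

definition coloring_gf :: "nat \<Rightarrow> (nat \<Rightarrow> enat) \<Rightarrow> int fps" where
  "coloring_gf q v = Abs_fps (\<lambda>b. if b \<ge> 1 then int (coloring_count b q v) else 0)"

text \<open>The substitution \<open>F(C(z), D(t))\<close>, meaningful if \<open>C\<close> and \<open>D\<close> have no constant term:
  \<open>D\<close> is substituted into each coefficient, and then \<open>C\<close>, read as a series in \<open>z\<close> with
  coefficients constant in \<open>t\<close>, is substituted for the outer variable.\<close>

definition fps_subst2 :: "int fps fps \<Rightarrow> int fps \<Rightarrow> int fps \<Rightarrow> int fps fps" where
  "fps_subst2 F C D =
     fps_compose (Abs_fps (\<lambda>i. fps_compose (F $ i) D)) (Abs_fps (\<lambda>n. fps_const (C $ n)))"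

lemma fps_const_coeffs_power:
  fixes C :: "'a::comm_semiring_1 fps"
  shows "Abs_fps (\<lambda>n. fps_const (C $ n)) ^ i = Abs_fps (\<lambda>n. fps_const ((C ^ i) $ n))"
proof (induction i)
  case 0
  show ?case by (rule fps_ext) simp
next
  case (Suc i)
  have sum_const: "(\<Sum>k\<in>A. fps_const (g k)) = fps_const (\<Sum>k\<in>A. g k)"
    for g :: "nat \<Rightarrow> 'a" and A
    by (induction A rule: infinite_finite_induct) auto
  show ?case
    unfolding power_Suc Suc
    by (rule fps_ext) (simp only: fps_mult_nth fps_nth_Abs_fps fps_const_mult sum_const)
qed

lemma fps_subst2_nth:
  "fps_subst2 F C D $ n $ m = (\<Sum>i=0..n. \<Sum>j=0..m. F $ i $ j * (C ^ i) $ n * (D ^ j) $ m)"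
  by (simp add: fps_subst2_def fps_compose_nth fps_const_coeffs_power fps_sum_nth
      sum_distrib_left sum_distrib_right mult_ac)

section \<open>The counted sets are finite\<close>

lemma finite_colorings: "finite (colorings b q v)"
proof (rule finite_subset)
  show "colorings b q v \<subseteq> {c. set c \<subseteq> {1..q} \<and> length c = b}"
    by (auto simp: colorings_def)
qed (simp add: finite_lists_length_eq)

lemma matched_pair_append1:
  assumes "matched_pair w i k l"
  shows "matched_pair (w @ w') i k l"
  using assms by (auto simp: matched_pair_def nth_append)

lemma matched_pair_append2:
  assumes "matched_pair w i k l"
  shows "matched_pair (w' @ w) i (length w' + k) (length w' + l)"
  using assms by (auto simp: matched_pair_def nth_append)

lemma balanced_left_matched:
  assumes "balanced w" "k < length w" "w ! k = LBr i"
  shows "\<exists>l. matched_pair w i k l"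
  using assms
proof (induction arbitrary: k i)
  case (balanced_bracket w i')
  show ?case
  proof (cases k)
    case 0
    with balanced_bracket show ?thesis
      by (intro exI[of _ "Suc (length w)"]) (auto simp: matched_pair_def nth_append)
  next
    case (Suc k')
    with balanced_bracket.prems have "k' < length w" "w ! k' = LBr i"
      by (auto simp: nth_append less_Suc_eq split: if_splits)
    then obtain l where "matched_pair w i k' l"
      using balanced_bracket.IH by blast
    from matched_pair_append2[OF matched_pair_append1[OF this, of "[RBr i']"], of "[LBr i']"]
    show ?thesis using Suc by auto
  qed
next
  case (balanced_append w w')
  show ?case
  proof (cases "k < length w")
    case True
    with balanced_append show ?thesis
      by (metis matched_pair_append1 nth_append)
  next
    case False
    with balanced_append.prems have "k - length w < length w'" "w' ! (k - length w) = LBr i"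
      by (auto simp: nth_append)
    then obtain l where "matched_pair w' i (k - length w) l"
      using balanced_append.IH by blast
    from matched_pair_append2[OF this, of w] show ?thesis
      using False by auto
  qed
qed simp_all

lemma balanced_length_le:
  assumes "balanced w"
  shows "length w \<le> 2 * degree w + arity w"
proof -
  let ?M = "{(k, l). \<exists>i. matched_pair w i k l}"
  have len: "length w = 2 * length (filter is_left w) + arity w"
    using assms by induction (auto simp: arity_def)
  have "?M \<subseteq> {..<length w} \<times> {..<length w}"
    by (auto simp: matched_pair_def)
  then have fin: "finite ?M"
    by (rule finite_subset) simp
  have "{k. k < length w \<and> is_left (w ! k)} \<subseteq> fst ` ?M"
  proof
    fix k assume "k \<in> {k. k < length w \<and> is_left (w ! k)}"
    then obtain i where "k < length w" "w ! k = LBr i"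
      by (auto simp: is_left_def)
    then obtain l where "matched_pair w i k l"
      using balanced_left_matched[OF assms] by blast
    then have "(k, l) \<in> ?M" by auto
    then show "k \<in> fst ` ?M" by (rule image_eqI[rotated]) simp
  qed
  then have "card {k. k < length w \<and> is_left (w ! k)} \<le> card ?M"
    by (rule surj_card_le[OF fin])
  then show ?thesis
    unfolding degree_def using len length_filter_conv_card[of is_left w] by linarith
qed

lemma finite_rb_words: "finite {w \<in> rb_words p q u v. degree w = n \<and> arity w = m}"
proof (rule finite_subset)
  let ?A = "Gen ` {1..q} \<union> LBr ` {1..p} \<union> RBr ` {1..p}"
  show "{w \<in> rb_words p q u v. degree w = n \<and> arity w = m}
      \<subseteq> {w. set w \<subseteq> ?A \<and> length w \<le> 2 * n + m}"
    using balanced_length_le by (auto simp: rb_words_def rb_word_def)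
  show "finite {w. set w \<subseteq> ?A \<and> length w \<le> 2 * n + m}"
    by (rule finite_lists_length_le) simp
qed

end

theory Submission
  imports Defs "HOL-Library.Sublist"
begin

text \<open>A Rota-Baxter word is an alternating sequence of blocks of generators and of bracketed words.
  If every block of generators is shrunk to a single \<open>x\<close>, and every maximal nest of
  brackets with nothing between consecutive brackets to a single pair, what remains is a word
  with \<open>p = q = 1\<close> and all exponents \<open>1\<close>.  Conversely, such a
  skeleton is filled in by choosing independently a coloring for each \<open>x\<close> and for
  each pair: the subscripts along a block of \<open>b\<close> generators form a coloring of
  \<open>b\<close> objects, the subscripts along a nest of \<open>a\<close> pairs form a
  coloring of \<open>a\<close> objects, and the bounds on the runs of the word are exactly the
  bounds on the runs of these colorings.

  The proof follows this idea one level at a time, through generating functions.  Let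
  \<open>X\<close>, \<open>L\<close> and \<open>K\<close> be the series of the words that start with
  a generator, that start with a left bracket, and that consist of one pair with its content.
  Splitting off the first block of generators, the first bracketed factor and the outermost
  nest of brackets gives
  \<open>X = D (1 + L)\<close>, \<open>L = K (1 + X)\<close> and
  \<open>K = C (X + L - K)\<close>, where \<open>C\<close> and \<open>D\<close> are the coloring
  series in \<open>z\<close> and \<open>t\<close>, and the series of all words is
  \<open>1 + X + L\<close> (lemma \<open>rb_words_block_equations\<close>).  The factor
  \<open>X + L - K\<close> counts the possible contents of a maximal nest: the nonempty words that
  are not themselves enclosed in a pair.

  These equations determine \<open>X\<close> and \<open>L\<close>
  (lemma \<open>block_equations_unique\<close>).  For \<open>p = q = 1\<close> and exponents
  \<open>1\<close> the coloring series are \<open>z\<close> and \<open>t\<close>.  Substitution is a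
  ring homomorphism, so substituting \<open>C\<close> and \<open>D\<close> into that solution solves
  the general equations, and the two solutions agree.\<close>

section \<open>Blocks of equal entries\<close>

lemma sublist_replicate_iff:
  "sublist (replicate n x) xs \<longleftrightarrow> (\<exists>k. k + n \<le> length xs \<and> (\<forall>d<n. xs ! (k + d) = x))"
proof
  assume "sublist (replicate n x) xs"
  then obtain ys zs where "xs = ys @ replicate n x @ zs"
    by (auto simp: sublist_def)
  then show "\<exists>k. k + n \<le> length xs \<and> (\<forall>d<n. xs ! (k + d) = x)"
    by (intro exI[of _ "length ys"]) (auto simp: nth_append)
next
  assume "\<exists>k. k + n \<le> length xs \<and> (\<forall>d<n. xs ! (k + d) = x)"
  then obtain k where k: "k + n \<le> length xs" "\<forall>d<n. xs ! (k + d) = x"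
    by blast
  have "take n (drop k xs) = replicate n x"
    using k by (intro nth_equalityI) auto
  then show "sublist (replicate n x) xs"
    by (metis append_take_drop_id sublist_appendI)
qed

text \<open>A bound on the maximal blocks is the same as a bound on all blocks, because a longest block is
  maximal.  Blocks that need not be maximal are closed under shortening and carry no condition
  on their neighbours, which makes them easy to follow through concatenations.\<close>

lemma runs_bounded_iff:
  "(\<forall>s l. is_run x xs s l \<longrightarrow> enat l \<le> b) \<longleftrightarrow> (\<forall>l. sublist (replicate l x) xs \<longrightarrow> enat l \<le> b)"
proof (intro iffI allI impI)
  fix s l
  assume *: "\<forall>l. sublist (replicate l x) xs \<longrightarrow> enat l \<le> b" and run: "is_run x xs s l"
  have "sublist (replicate l x) xs"
    unfolding sublist_replicate_iff using run by (intro exI[of _ s]) (auto simp: is_run_def)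
  with * show "enat l \<le> b" by blast
next
  fix l
  assume *: "\<forall>s l. is_run x xs s l \<longrightarrow> enat l \<le> b" and l: "sublist (replicate l x) xs"
  let ?P = "\<lambda>n. sublist (replicate n x) xs"
  have bound: "n \<le> length xs" if "?P n" for n
    using sublist_length_le[OF that] by simp
  define N where "N = (GREATEST n. ?P n)"
  have N: "?P N" "\<And>n. ?P n \<Longrightarrow> n \<le> N"
    unfolding N_def using GreatestI_nat[of ?P, OF l bound] Greatest_le_nat[of ?P, OF _ bound]
    by blast+
  show "enat l \<le> b"
  proof (cases "N = 0")
    case True
    then show ?thesis using N(2)[OF l] by (simp flip: zero_enat_def)
  next
    case False
    obtain k where k: "k + N \<le> length xs" "\<forall>d<N. xs ! (k + d) = x"
      using N(1) unfolding sublist_replicate_iff by blast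
    have no_longer: "\<not> ?P (Suc N)" using N(2)[of "Suc N"] by auto
    have "is_run x xs k N"
      unfolding is_run_def
    proof (intro conjI)
      show "\<forall>i\<in>{k..<k + N}. xs ! i = x"
      proof
        fix i assume "i \<in> {k..<k + N}"
        with k(2)[rule_format, of "i - k"] show "xs ! i = x" by auto
      qed
      show "k = 0 \<or> xs ! (k - 1) \<noteq> x"
      proof (rule ccontr)
        assume "\<not> ?thesis"
        then have "\<forall>d<Suc N. xs ! (k - 1 + d) = x" "0 < k"
          using k(2) by (auto simp: less_Suc_eq_0_disj)
        then have "?P (Suc N)"
          unfolding sublist_replicate_iff using k(1) by (intro exI[of _ "k - 1"]) auto
        with no_longer show False ..
      qed
      show "k + N = length xs \<or> xs ! (k + N) \<noteq> x"
      proof (rule ccontr)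
        assume "\<not> ?thesis"
        then have "?P (Suc N)"
          unfolding sublist_replicate_iff using k by (intro exI[of _ k]) (auto simp: less_Suc_eq)
        with no_longer show False ..
      qed
    qed (use False k in auto)
    then have "enat N \<le> b" using * by blast
    then show ?thesis using N(2)[OF l] by (meson enat_ord_simps(1) order_trans)
  qed
qed

text \<open>If the two entries at the seam are not both \<open>x\<close>, no block of \<open>x\<close>
  crosses the seam.\<close>

lemma sublist_replicate_append_iff:
  assumes "a = [] \<or> b = [] \<or> \<not> (last a = x \<and> hd b = x)"
  shows "sublist (replicate l x) (a @ b) \<longleftrightarrow>
           sublist (replicate l x) a \<or> sublist (replicate l x) b"
proof -
  have False if "replicate l x = xs @ ys" "suffix xs a" "prefix ys b" "xs \<noteq> []" "ys \<noteq> []" for xs ys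
  proof -
    have "set xs \<subseteq> {x}" "set ys \<subseteq> {x}"
      using that(1) by (metis set_append set_replicate_conv_if sup_ge1 sup_ge2 empty_subsetI order_trans)+
    moreover have "last a = last xs" "hd b = hd ys" "a \<noteq> []" "b \<noteq> []"
      using that by (auto simp: suffix_def prefix_def)
    ultimately show False
      using assms that(4,5) last_in_set[of xs] hd_in_set[of ys] by (metis singletonD subsetD)
  qed
  then show ?thesis
    unfolding sublist_append by (metis append_Nil append_Nil2 prefix_imp_sublist suffix_imp_sublist)
qed

lemma sublist_replicate_map_iff:
  assumes "inj f"
  shows "sublist (replicate l (f x)) (map f xs) \<longleftrightarrow> sublist (replicate l x) xs"
  using assms by (auto simp: sublist_replicate_iff inj_eq)

section \<open>Balanced words\<close>

definition height :: "rb_symbol list \<Rightarrow> int" where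
  "height w = int (length (filter is_left w)) - int (length (filter is_right w))"

lemma height_simps [simp]:
  "height [] = 0" "height (LBr i # w) = height w + 1" "height (RBr i # w) = height w - 1"
  "height (Gen i # w) = height w" "height (v @ w) = height v + height w"
  by (auto simp: height_def)

lemma balanced_height:
  assumes "balanced w"
  shows "height w = 0" and "height (take k w) \<ge> 0"
proof -
  have "height w = 0 \<and> (\<forall>k. height (take k w) \<ge> 0)"
    using assms by induction (auto simp: take_Cons split: nat.splits)
  then show "height w = 0" and "height (take k w) \<ge> 0" by auto
qed

text \<open>A right bracket after a balanced word takes the height to \<open>-1\<close>, which happens in
  no prefix of a balanced word.  So the first right bracket without a partner marks the end
  of the balanced prefix.  Hence partners are unique, and so is the first bracketed factor of
  a word.\<close>

lemma balanced_prefix_unique: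
  assumes "balanced a" "balanced b" "a @ RBr i # x = b @ RBr j # y"
  shows "a = b \<and> i = j \<and> x = y"
proof -
  have *: "\<not> length a < length b"
    if "balanced a" "balanced b" "a @ RBr i # x = b @ RBr j # y" for a b x y i j
  proof
    assume "length a < length b"
    then have "take (Suc (length a)) (b @ RBr j # y) = take (Suc (length a)) b" by simp
    then have "take (Suc (length a)) b = a @ [RBr i]"
      using that(3) by (metis append_Cons append_Nil append_assoc append_eq_conv_conj length_append_singleton)
    with balanced_height(2)[OF that(2), of "Suc (length a)"] balanced_height(1)[OF that(1)]
    show False by simp
  qed
  have "length a = length b"
    using *[OF assms] *[OF assms(2,1) assms(3)[symmetric]] by simp
  with assms(3) show ?thesis by auto
qed

text \<open>The rules that define balanced words are ambiguous because of concatenation; reading from the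
  left gives an unambiguous case distinction.\<close>

lemma balanced_cases:
  assumes "balanced w"
  obtains "w = []"
  | j b where "w = Gen j # b" "balanced b"
  | i a b where "w = LBr i # a @ RBr i # b" "balanced a" "balanced b"
proof -
  have "w = [] \<or> (\<exists>j b. w = Gen j # b \<and> balanced b) \<or>
      (\<exists>i a b. w = LBr i # a @ RBr i # b \<and> balanced a \<and> balanced b)"
    using assms
  proof induction
    case (balanced_append w w')
    then show ?case
      by (metis append.assoc append.left_neutral append_Cons balanced.balanced_append)
  qed (auto intro: balanced.intros)
  then show ?thesis using that by blast
qed

lemma balanced_hd: "balanced w \<Longrightarrow> w \<noteq> [] \<Longrightarrow> \<not> is_right (hd w)"
  by (erule balanced_cases) auto

lemma balanced_last:
  assumes "balanced w" "w \<noteq> []"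
  shows "\<not> is_left (last w)"
proof
  assume "is_left (last w)"
  then have "height [last w] = 1" by (auto simp: is_left_def)
  moreover have "height w = height (butlast w) + height [last w]"
    using assms(2) by (metis append_butlast_last_id height_simps(5))
  moreover have "height (butlast w) \<ge> 0"
    using balanced_height(2)[OF assms(1)] by (simp add: butlast_conv_take)
  ultimately show False using balanced_height(1)[OF assms(1)] by simp
qed

lemma balanced_map_Gen: "balanced (map Gen c)"
proof (induction c)
  case (Cons j c)
  from balanced_append[OF balanced_gen this] show ?case by simp
qed (simp add: balanced_empty)

lemma balanced_map_Gen_append_iff: "balanced (map Gen c @ w) \<longleftrightarrow> balanced w"
proof
  assume "balanced (map Gen c @ w)"
  then show "balanced w"
    by (induction c) (auto elim: balanced_cases)
qed (rule balanced_append[OF balanced_map_Gen])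

section \<open>Matched pairs\<close>

lemma matched_pair_iff:
  "matched_pair w i k l \<longleftrightarrow> (\<exists>x a y. w = x @ LBr i # a @ RBr i # y \<and> balanced a \<and>
     k = length x \<and> l = Suc (length x + length a))"
proof
  assume mp: "matched_pair w i k l"
  let ?a = "take (l - Suc k) (drop (Suc k) w)"
  have "k < l" "l < length w" and sym: "w ! k = LBr i" "w ! l = RBr i" and "balanced ?a"
    using mp by (auto simp: matched_pair_def)
  have "w = take k w @ w ! k # drop (Suc k) w"
    using \<open>k < l\<close> \<open>l < length w\<close> by (simp add: id_take_nth_drop)
  also have "drop (Suc k) w = ?a @ drop (l - Suc k) (drop (Suc k) w)"
    by (simp only: append_take_drop_id)
  also have "drop (l - Suc k) (drop (Suc k) w) = w ! l # drop (Suc l) w"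
    using \<open>k < l\<close> \<open>l < length w\<close> by (simp add: Cons_nth_drop_Suc)
  finally have "w = take k w @ LBr i # ?a @ RBr i # drop (Suc l) w"
    using sym by simp
  then show "\<exists>x a y. w = x @ LBr i # a @ RBr i # y \<and> balanced a \<and>
     k = length x \<and> l = Suc (length x + length a)"
    using \<open>balanced ?a\<close> \<open>k < l\<close> \<open>l < length w\<close>
    by (intro exI[of _ "take k w"] exI[of _ ?a] exI[of _ "drop (Suc l) w"]) auto
next
  assume "\<exists>x a y. w = x @ LBr i # a @ RBr i # y \<and> balanced a \<and>
     k = length x \<and> l = Suc (length x + length a)"
  then show "matched_pair w i k l"
    by (auto simp: matched_pair_def nth_append)
qed

lemma matched_pair_unique:
  assumes "matched_pair w i k l" "matched_pair w j k l'"
  shows "i = j \<and> l = l'"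
proof -
  from assms(1) obtain x a y where 1: "w = x @ LBr i # a @ RBr i # y" "balanced a"
     "k = length x" "l = Suc (length x + length a)"
    unfolding matched_pair_iff by blast
  from assms(2) obtain x' a' y' where 2: "w = x' @ LBr j # a' @ RBr j # y'" "balanced a'"
     "k = length x'" "l' = Suc (length x' + length a')"
    unfolding matched_pair_iff by blast
  have "x = x' \<and> LBr i # a @ RBr i # y = LBr j # a' @ RBr j # y'"
    using 1 2 by (metis append_eq_append_conv)
  then have "i = j" "length x = length x'" "a @ RBr i # y = a' @ RBr j # y'"
    by auto
  with balanced_prefix_unique[OF 1(2) 2(2), of i y j y'] show ?thesis
    by (simp add: 1(4) 2(4))
qed

text \<open>Each left bracket has exactly one partner, so counting left brackets replaces counting
  matched pairs and makes the degree visibly additive.\<close>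

lemma degree_eq_lefts:
  assumes "balanced w"
  shows "degree w = length (filter is_left w)"
proof -
  let ?M = "{(k, l). \<exists>i. matched_pair w i k l}"
  have "bij_betw fst ?M {k. k < length w \<and> is_left (w ! k)}"
    unfolding bij_betw_def
  proof
    show "inj_on fst ?M"
      using matched_pair_unique by (auto simp: inj_on_def)
    show "fst ` ?M = {k. k < length w \<and> is_left (w ! k)}"
      using balanced_left_matched[OF assms]
      by (force simp: matched_pair_def is_left_def image_iff)
  qed
  then show ?thesis
    unfolding degree_def by (simp add: bij_betw_same_card length_filter_conv_card)
qed

text \<open>A left bracket in a balanced prefix already has its partner there, and partners are unique.\<close>

lemma matched_pair_append_iff1:
  assumes "balanced a" "k < length a"
  shows "matched_pair (a @ b) i k l \<longleftrightarrow> matched_pair a i k l"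
proof
  assume mp: "matched_pair (a @ b) i k l"
  then have "a ! k = LBr i"
    using assms(2) by (auto simp: matched_pair_def nth_append)
  then obtain l' where l': "matched_pair a i k l'"
    using balanced_left_matched[OF assms] by blast
  from matched_pair_unique[OF mp matched_pair_append1[OF this]] l' show "matched_pair a i k l"
    by simp
qed (rule matched_pair_append1)

lemma matched_pair_append_iff2:
  assumes "length a \<le> k"
  shows "matched_pair (a @ b) i k l \<longleftrightarrow>
           length a \<le> l \<and> matched_pair b i (k - length a) (l - length a)"
  using assms by (auto simp: matched_pair_def nth_append Suc_diff_le)

definition enclosed :: "rb_symbol list \<Rightarrow> bool" where
  "enclosed w \<longleftrightarrow> (\<exists>i a. balanced a \<and> w = LBr i # a @ [RBr i])"

lemma matched_pair_whole_iff_enclosed: "(\<exists>i. matched_pair w i 0 (length w - 1)) \<longleftrightarrow> enclosed w"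
proof
  assume "enclosed w"
  then obtain i a where "balanced a" "w = LBr i # a @ [RBr i]"
    by (auto simp: enclosed_def)
  then show "\<exists>i. matched_pair w i 0 (length w - 1)"
    unfolding matched_pair_iff by (intro exI[of _ i] exI[of _ "[]"] exI[of _ a]) auto
qed (fastforce simp: matched_pair_iff enclosed_def)

text \<open>The nest of brackets with subscripts \<open>c\<close>, listed from the outside to the inside,
  around the content \<open>m\<close>.\<close>

definition wrap :: "nat list \<Rightarrow> rb_symbol list \<Rightarrow> rb_symbol list" where
  "wrap c m = map LBr c @ m @ map RBr (rev c)"

lemma wrap_simps [simp]:
  "wrap [] m = m" "wrap (i # c) m = LBr i # wrap c m @ [RBr i]"
  "length (wrap c m) = length c + length m + length c"
  by (auto simp: wrap_def)

lemma balanced_wrap: "balanced m \<Longrightarrow> balanced (wrap c m)"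
  by (induction c) (auto intro: balanced_bracket)

lemma enclosed_wrap: "balanced m \<Longrightarrow> c \<noteq> [] \<Longrightarrow> enclosed (wrap c m)"
  by (cases c) (auto simp: enclosed_def balanced_wrap)

text \<open>Peeling off outer pairs as long as possible; with \<open>wrap_inject\<close>, the result is
  unique.\<close>

lemma enclosed_obtain_wrap:
  assumes "enclosed w"
  obtains c m where "c \<noteq> []" "balanced m" "\<not> enclosed m" "w = wrap c m"
proof -
  have "\<exists>c m. c \<noteq> [] \<and> balanced m \<and> \<not> enclosed m \<and> w = wrap c m"
    using assms
  proof (induction w rule: length_induct)
    case (1 w)
    then obtain i a where a: "balanced a" "w = LBr i # a @ [RBr i]"
      by (auto simp: enclosed_def)
    show ?case
    proof (cases "enclosed a")
      case True
      with 1 a obtain c m where "balanced m" "\<not> enclosed m" "a = wrap c m"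
        by force
      with a show ?thesis by (intro exI[of _ "i # c"] exI[of _ m]) auto
    next
      case False
      with a show ?thesis by (intro exI[of _ "[i]"] exI[of _ a]) auto
    qed
  qed
  then show ?thesis using that by blast
qed

lemma wrap_inject:
  assumes "balanced m" "balanced m'" "\<not> enclosed m" "\<not> enclosed m'" "wrap c m = wrap c' m'"
  shows "c = c' \<and> m = m'"
  using assms(5)
proof (induction c arbitrary: c')
  case Nil
  then show ?case using assms enclosed_wrap by (cases "c' = []") auto
next
  case (Cons i c)
  have "c' \<noteq> []" using Cons.prems assms enclosed_wrap[OF assms(1), of "i # c"] by auto
  then show ?case using Cons by (cases c') auto
qed

lemma matched_pair_bracket_iff:
  assumes "balanced a"
  shows "matched_pair (LBr i # a @ [RBr i]) j k l \<longleftrightarrow>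
    j = i \<and> k = 0 \<and> l = Suc (length a) \<or> k \<ge> 1 \<and> l \<ge> 1 \<and> matched_pair a j (k - 1) (l - 1)"
    (is "matched_pair ?w j k l \<longleftrightarrow> _")
proof (cases k)
  case 0
  have "matched_pair ?w i 0 (Suc (length a))"
    using assms by (auto simp: matched_pair_def nth_append)
  then show ?thesis using 0 matched_pair_unique by auto
next
  case (Suc k')
  have "matched_pair (a @ [RBr i]) j k' l' \<longleftrightarrow> matched_pair a j k' l'" for l'
  proof (cases "k' < length a")
    case True
    then show ?thesis by (rule matched_pair_append_iff1[OF assms])
  next
    case False
    then show ?thesis by (auto simp: matched_pair_def nth_append)
  qed
  then show ?thesis
    using Suc matched_pair_append_iff2[of "[LBr i]" k "a @ [RBr i]"] by auto
qed

text \<open>The pairs of a nest are placed symmetrically: partners in the outer layers are equally far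
  from the two ends.  All other pairs lie in the content.\<close>

lemma matched_pair_wrap_iff:
  assumes "balanced m"
  shows "matched_pair (wrap c m) i k l \<longleftrightarrow>
    k < length c \<and> c ! k = i \<and> Suc (k + l) = length (wrap c m) \<or>
    k \<ge> length c \<and> l \<ge> length c \<and> matched_pair m i (k - length c) (l - length c)"
proof (induction c arbitrary: k l)
  case (Cons j c)
  show ?case
    using Cons[of "k - 1" "l - 1"]
    by (cases k; cases l) (auto simp: matched_pair_bracket_iff[OF balanced_wrap[OF assms]])
qed simp

section \<open>Bounded operator runs\<close>

text \<open>Chains of immediately nested pairs of one subscript, not necessarily maximal.  They play the
  part for operators that blocks of equal entries play for generators.\<close>

definition operator_chain :: "nat \<Rightarrow> rb_symbol list \<Rightarrow> nat \<Rightarrow> nat \<Rightarrow> nat \<Rightarrow> bool" where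
  "operator_chain i w k l n \<longleftrightarrow> (\<forall>d<n. matched_pair w i (k + d) (l - d))"

definition chain_length :: "nat \<Rightarrow> rb_symbol list \<Rightarrow> nat \<Rightarrow> bool" where
  "chain_length i w n \<longleftrightarrow> (\<exists>k l. operator_chain i w k l n)"

lemma chain_length_0 [simp]: "chain_length i w 0"
  by (simp add: chain_length_def operator_chain_def)

text \<open>A longest chain can be extended neither inwards nor outwards, hence is a run.\<close>

lemma operator_runs_bounded_iff:
  "(\<forall>k l n. is_operator_run i w k l n \<longrightarrow> enat n \<le> b) \<longleftrightarrow>
   (\<forall>n. chain_length i w n \<longrightarrow> enat n \<le> b)"
proof (intro iffI allI impI)
  fix k l n
  assume "\<forall>n. chain_length i w n \<longrightarrow> enat n \<le> b" "is_operator_run i w k l n"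
  then show "enat n \<le> b"
    unfolding chain_length_def operator_chain_def is_operator_run_def by blast
next
  fix n
  assume *: "\<forall>k l n. is_operator_run i w k l n \<longrightarrow> enat n \<le> b" and n: "chain_length i w n"
  let ?P = "chain_length i w"
  have bound: "n \<le> length w" if "?P n" for n
  proof (cases n)
    case (Suc n')
    with that obtain k l where "matched_pair w i (k + n') (l - n')"
      by (auto simp: chain_length_def operator_chain_def)
    then show ?thesis using Suc by (auto simp: matched_pair_def)
  qed simp
  define N where "N = (GREATEST n. ?P n)"
  have N: "?P N" "\<And>n. ?P n \<Longrightarrow> n \<le> N"
    unfolding N_def using GreatestI_nat[of ?P, OF n bound] Greatest_le_nat[of ?P, OF _ bound]
    by blast+
  have no_longer: "\<not> operator_chain i w k l (Suc N)" for k l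
    using N(2)[of "Suc N"] by (auto simp: chain_length_def)
  show "enat n \<le> b"
  proof (cases "N = 0")
    case True
    then show ?thesis using N(2)[OF n] by (simp flip: zero_enat_def)
  next
    case False
    obtain k l where kl: "operator_chain i w k l N"
      using N(1) by (auto simp: chain_length_def)
    have "\<not> matched_pair w i (k + N) (l - N)"
      using no_longer[of k l] kl by (auto simp: operator_chain_def less_Suc_eq)
    moreover have "k = 0 \<or> \<not> matched_pair w i (k - 1) (l + 1)"
      using no_longer[of "k - 1" "l + 1"] kl by (auto simp: operator_chain_def less_Suc_eq_0_disj)
    ultimately have "is_operator_run i w k l N"
      using kl False by (auto simp: is_operator_run_def operator_chain_def)
    then have "enat N \<le> b" using * by blast
    then show ?thesis using N(2)[OF n] by (meson enat_ord_simps(1) order_trans)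
  qed
qed

text \<open>All pairs of a chain lie inside its outermost pair, so a chain cannot leave the factor in
  which it starts.\<close>

lemma chain_length_append_iff:
  assumes "balanced a"
  shows "chain_length i (a @ b) n \<longleftrightarrow> chain_length i a n \<or> chain_length i b n"
proof
  assume "chain_length i (a @ b) n"
  then obtain k l where kl: "\<And>d. d < n \<Longrightarrow> matched_pair (a @ b) i (k + d) (l - d)"
    by (auto simp: chain_length_def operator_chain_def)
  show "chain_length i a n \<or> chain_length i b n"
  proof (cases "k < length a")
    case True
    have "matched_pair a i (k + d) (l - d)" if "d < n" for d
    proof -
      have "l < length a"
        using kl[of 0] that True assms
        by (simp add: matched_pair_append_iff1) (simp add: matched_pair_def)
      moreover have "k + d < l - d" using kl[OF that] by (simp add: matched_pair_def)
      ultimately show ?thesis using kl[OF that] assms by (simp add: matched_pair_append_iff1)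
    qed
    then show ?thesis by (auto simp: chain_length_def operator_chain_def)
  next
    case False
    have "matched_pair b i (k - length a + d) (l - length a - d)" if "d < n" for d
      using kl[OF that] False by (simp add: matched_pair_append_iff2 add.commute)
    then show ?thesis unfolding chain_length_def operator_chain_def by blast
  qed
next
  assume "chain_length i a n \<or> chain_length i b n"
  then show "chain_length i (a @ b) n"
  proof
    assume "chain_length i a n"
    then show ?thesis
      by (auto simp: chain_length_def operator_chain_def intro: matched_pair_append1)
  next
    assume "chain_length i b n"
    then obtain k l where kl: "\<And>d. d < n \<Longrightarrow> matched_pair b i (k + d) (l - d)"
      by (auto simp: chain_length_def operator_chain_def)
    have "matched_pair (a @ b) i (length a + k + d) (length a + l - d)" if "d < n" for d
    proof -
      have "d \<le> l" using kl[OF that] by (auto simp: matched_pair_def)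
      then show ?thesis using matched_pair_append2[OF kl[OF that], of a] by (simp add: add.assoc)
    qed
    then show ?thesis by (auto simp: chain_length_def operator_chain_def)
  qed
qed

text \<open>A chain that starts in the layers of the nest could reach the content only through a pair
  that encloses the whole content, and there is none.  So it stays in the layers, where it is a
  block of equal subscripts.\<close>

lemma chain_length_wrap_iff:
  assumes "balanced m" "\<not> enclosed m"
  shows "chain_length i (wrap c m) n \<longleftrightarrow> sublist (replicate n i) c \<or> chain_length i m n"
proof
  assume "chain_length i (wrap c m) n"
  then obtain k l where kl: "\<And>d. d < n \<Longrightarrow> matched_pair (wrap c m) i (k + d) (l - d)"
    by (auto simp: chain_length_def operator_chain_def)
  show "sublist (replicate n i) c \<or> chain_length i m n"
  proof (cases "k < length c")
    case k: True
    show ?thesis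
    proof (cases "n = 0")
      case False
      then have l: "Suc (k + l) = length (wrap c m)"
        using kl[of 0] k assms(1) by (simp add: matched_pair_wrap_iff)
      have "k + n \<le> length c"
      proof (rule ccontr)
        assume "\<not> k + n \<le> length c"
        then have "matched_pair (wrap c m) i (length c) (l - (length c - k))"
          using kl[of "length c - k"] k by simp
        then have "matched_pair m i 0 (l - (length c - k) - length c)"
          using assms(1) by (simp add: matched_pair_wrap_iff)
        moreover have "l - (length c - k) - length c = length m - 1"
          using l k by simp
        ultimately show False
          using assms(2) matched_pair_whole_iff_enclosed by metis
      qed
      moreover have "c ! (k + d) = i" if "d < n" for d
        using kl[OF that] that calculation assms(1) by (simp add: matched_pair_wrap_iff)
      ultimately show ?thesis unfolding sublist_replicate_iff by blast
    qed simp
  next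
    case False
    have "matched_pair m i (k - length c + d) (l - length c - d)" if "d < n" for d
      using kl[OF that] False assms(1) by (simp add: matched_pair_wrap_iff add.commute)
    then show ?thesis unfolding chain_length_def operator_chain_def by blast
  qed
next
  assume "sublist (replicate n i) c \<or> chain_length i m n"
  then show "chain_length i (wrap c m) n"
  proof
    assume "sublist (replicate n i) c"
    then obtain k where k: "k + n \<le> length c" "\<And>d. d < n \<Longrightarrow> c ! (k + d) = i"
      unfolding sublist_replicate_iff by blast
    have "matched_pair (wrap c m) i (k + d) (length (wrap c m) - Suc k - d)" if "d < n" for d
      using k that assms(1) by (simp add: matched_pair_wrap_iff)
    then show ?thesis unfolding chain_length_def operator_chain_def by blast
  next
    assume "chain_length i m n"
    then obtain k l where kl: "\<And>d. d < n \<Longrightarrow> matched_pair m i (k + d) (l - d)"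
      by (auto simp: chain_length_def operator_chain_def)
    have "matched_pair (wrap c m) i (length c + k + d) (length c + l - d)" if "d < n" for d
    proof -
      have "d \<le> l" using kl[OF that] by (auto simp: matched_pair_def)
      then show ?thesis using kl[OF that] assms(1) by (simp add: matched_pair_wrap_iff)
    qed
    then show ?thesis unfolding chain_length_def operator_chain_def by blast
  qed
qed

section \<open>Generating functions of weighted sets\<close>

definition weight_gf :: "('a \<Rightarrow> nat) \<Rightarrow> ('a \<Rightarrow> nat) \<Rightarrow> 'a set \<Rightarrow> int fps fps" where
  "weight_gf d e A = Abs_fps (\<lambda>n. Abs_fps (\<lambda>m. int (card {x \<in> A. d x = n \<and> e x = m})))"

definition finite_levels :: "('a \<Rightarrow> nat) \<Rightarrow> ('a \<Rightarrow> nat) \<Rightarrow> 'a set \<Rightarrow> bool" where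
  "finite_levels d e A \<longleftrightarrow> (\<forall>n m. finite {x \<in> A. d x = n \<and> e x = m})"

lemma finite_levels_subset:
  assumes "finite_levels d e B" "A \<subseteq> B"
  shows "finite_levels d e A"
  unfolding finite_levels_def
proof (intro allI)
  fix n m
  have "finite {x \<in> B. d x = n \<and> e x = m}"
    using assms(1) by (simp add: finite_levels_def)
  then show "finite {x \<in> A. d x = n \<and> e x = m}"
    by (rule rev_finite_subset) (use assms(2) in auto)
qed

lemma weight_gf_Un:
  assumes "finite_levels d e A" "finite_levels d e B" "A \<inter> B = {}"
  shows "weight_gf d e (A \<union> B) = weight_gf d e A + weight_gf d e B"
proof (intro fps_ext)
  fix n m
  have "{x \<in> A \<union> B. d x = n \<and> e x = m} =
      {x \<in> A. d x = n \<and> e x = m} \<union> {x \<in> B. d x = n \<and> e x = m}" by auto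
  moreover have "card \<dots> = card {x \<in> A. d x = n \<and> e x = m} + card {x \<in> B. d x = n \<and> e x = m}"
    using assms by (intro card_Un_disjoint) (auto simp: finite_levels_def)
  ultimately show "weight_gf d e (A \<union> B) $ n $ m = (weight_gf d e A + weight_gf d e B) $ n $ m"
    by (simp add: weight_gf_def)
qed

lemma weight_gf_singleton:
  assumes "d a = 0" "e a = 0"
  shows "weight_gf d e {a} = 1"
proof (intro fps_ext)
  fix n m
  have "{x \<in> {a}. d x = n \<and> e x = m} = (if n = 0 \<and> m = 0 then {a} else {})"
    using assms by auto
  then show "weight_gf d e {a} $ n $ m = 1 $ n $ m"
    by (simp add: weight_gf_def)
qed

text \<open>Pairs combined by an injective map with additive weights: the level of weight
  \<open>(n, m)\<close> splits into one product of levels for each way to write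
  \<open>(n, m)\<close> as a sum, which is the Cauchy product in both variables.\<close>

lemma weight_gf_times:
  assumes inj: "inj_on f (A \<times> B)"
    and d: "\<And>a b. a \<in> A \<Longrightarrow> b \<in> B \<Longrightarrow> d (f (a, b)) = d1 a + d2 b"
    and e: "\<And>a b. a \<in> A \<Longrightarrow> b \<in> B \<Longrightarrow> e (f (a, b)) = e1 a + e2 b"
    and fin: "finite_levels d1 e1 A" "finite_levels d2 e2 B"
  shows "weight_gf d e (f ` (A \<times> B)) = weight_gf d1 e1 A * weight_gf d2 e2 B"
proof (intro fps_ext)
  fix n m :: nat
  let ?I = "{0..n} \<times> {0..m}"
  let ?A = "\<lambda>i j. {a \<in> A. d1 a = i \<and> e1 a = j}"
  let ?B = "\<lambda>i j. {b \<in> B. d2 b = i \<and> e2 b = j}"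
  let ?S = "\<lambda>(i, j). ?A i j \<times> ?B (n - i) (m - j)"
  have level: "{x \<in> f ` (A \<times> B). d x = n \<and> e x = m} = f ` (\<Union>ij\<in>?I. ?S ij)"
  proof (intro equalityI subsetI)
    fix x assume "x \<in> {x \<in> f ` (A \<times> B). d x = n \<and> e x = m}"
    then obtain a b where ab: "a \<in> A" "b \<in> B" "x = f (a, b)" "d x = n" "e x = m" by auto
    then have "d1 a + d2 b = n" "e1 a + e2 b = m" using d e by auto
    with ab show "x \<in> f ` (\<Union>ij\<in>?I. ?S ij)"
      by (intro image_eqI[of _ _ "(a, b)"]) auto
  qed (auto simp: d e)
  have "card {x \<in> f ` (A \<times> B). d x = n \<and> e x = m} = card (\<Union>ij\<in>?I. ?S ij)"
    unfolding level by (rule card_image, rule inj_on_subset[OF inj]) auto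
  also have "\<dots> = (\<Sum>ij\<in>?I. card (?S ij))"
    using fin by (intro card_UN_disjoint) (auto simp: finite_levels_def)
  also have "\<dots> = (\<Sum>i=0..n. \<Sum>j=0..m. card (?A i j) * card (?B (n - i) (m - j)))"
    by (simp add: sum.cartesian_product split_def card_cartesian_product)
  finally show "weight_gf d e (f ` (A \<times> B)) $ n $ m = (weight_gf d1 e1 A * weight_gf d2 e2 B) $ n $ m"
    by (simp add: weight_gf_def fps_mult_nth fps_sum_nth)
qed

section \<open>Substitution\<close>

text \<open>The embedding of series in \<open>z\<close> into series in \<open>z\<close> and
  \<open>t\<close>; for series in \<open>t\<close> it is \<open>fps_const\<close>.\<close>

definition in_z :: "int fps \<Rightarrow> int fps fps" where
  "in_z C = Abs_fps (\<lambda>n. fps_const (C $ n))"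

lemma in_z_X: "in_z fps_X = fps_X"
  by (rule fps_ext) (simp add: in_z_def fps_X_def)

context
  fixes C D :: "int fps"
  assumes CD: "C $ 0 = 0" "D $ 0 = 0"
begin

lemma fps_subst2_add: "fps_subst2 (F + G) C D = fps_subst2 F C D + fps_subst2 G C D"
  by (intro fps_ext) (simp add: fps_subst2_nth algebra_simps sum.distrib)

lemma fps_subst2_diff: "fps_subst2 (F - G) C D = fps_subst2 F C D - fps_subst2 G C D"
  by (intro fps_ext) (simp add: fps_subst2_nth algebra_simps sum_subtractf)

lemma fps_subst2_mult: "fps_subst2 (F * G) C D = fps_subst2 F C D * fps_subst2 G C D"
proof -
  have "Abs_fps (\<lambda>i. (F * G) $ i oo D) = Abs_fps (\<lambda>i. F $ i oo D) * Abs_fps (\<lambda>i. G $ i oo D)"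
    by (rule fps_ext)
      (simp add: fps_mult_nth fps_compose_sum_distrib fps_compose_mult_distrib[OF CD(2)])
  then show ?thesis
    using CD(1) by (simp add: fps_subst2_def fps_compose_mult_distrib)
qed

lemma fps_subst2_1: "fps_subst2 1 C D = 1"
proof -
  have "Abs_fps (\<lambda>i. (1 :: int fps fps) $ i oo D) = 1"
    by (rule fps_ext) simp
  then show ?thesis by (simp add: fps_subst2_def)
qed

lemma fps_subst2_z: "fps_subst2 fps_X C D = in_z C"
proof -
  have "Abs_fps (\<lambda>i. (fps_X :: int fps fps) $ i oo D) = fps_X"
    by (rule fps_ext) (simp add: fps_X_def)
  then show ?thesis using CD(1) by (simp add: fps_subst2_def in_z_def)
qed

lemma fps_subst2_t: "fps_subst2 (fps_const fps_X) C D = fps_const D"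
proof -
  have "Abs_fps (\<lambda>i. (fps_const fps_X :: int fps fps) $ i oo D) = fps_const D"
    using CD(2) by (intro fps_ext) (simp split: if_splits)
  then show ?thesis by (simp add: fps_subst2_def)
qed

end

section \<open>A system of equations with a unique solution\<close>

text \<open>The equations for the series \<open>X\<close>, \<open>L\<close>, \<open>K\<close> of words that start
  with a generator, start with a left bracket, and are enclosed in a pair.\<close>

definition block_equations :: "'a::comm_ring_1 \<Rightarrow> 'a \<Rightarrow> 'a \<Rightarrow> 'a \<Rightarrow> 'a \<Rightarrow> bool" where
  "block_equations C D X L K \<longleftrightarrow> X = D * (1 + L) \<and> L = K * (1 + X) \<and> K = C * (X + L - K)"

text \<open>Subtracting two solutions leaves a homogeneous linear system for the three differences.
  Elimination turns it into \<open>E (L - L') = 0\<close>, where \<open>E\<close> has constant term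
  \<open>1\<close> because \<open>C\<close>, and with it \<open>K'\<close>, has none.  A ring of power
  series over an integral domain has no zero divisors, so \<open>L = L'\<close>.\<close>

lemma block_equations_unique:
  fixes C D :: "'a::idom fps"
  assumes C: "C $ 0 = 0" and "block_equations C D X L K" "block_equations C D X' L' K'"
  shows "X = X'" and "L = L'"
proof -
  have eqs: "X = D * (1 + L)" "L = K * (1 + X)" "K = C * (X + L - K)"
    "X' = D * (1 + L')" "L' = K' * (1 + X')" "K' = C * (X' + L' - K')"
    using assms(2,3) unfolding block_equations_def by blast+
  have dX: "X - X' = D * (L - L')"
    by (subst eqs(1), subst eqs(4)) (simp add: algebra_simps)
  have "L - L' = (K - K') * (1 + X) + K' * (X - X')"
    by (subst (1) eqs(2), subst (1) eqs(5)) (simp add: algebra_simps)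
  then have dL: "(1 - K' * D) * (L - L') = (K - K') * (1 + X)"
    unfolding dX by (simp add: algebra_simps)
  have "(1 + C) * (K - K') = C * ((X - X') + (L - L'))"
    using arg_cong2[OF eqs(3,6), of "(-)"] by (simp add: algebra_simps)
  then have dK: "(1 + C) * (K - K') = C * (1 + D) * (L - L')"
    unfolding dX by (simp add: algebra_simps)
  \<comment> \<open>The determinant of the linear system for \<open>L - L'\<close> and \<open>K - K'\<close>
    that is left after eliminating \<open>X - X'\<close>.\<close>
  define E where "E = (1 + C) * (1 - K' * D) - C * (1 + D) * (1 + X)"
  have "(1 + C) * ((1 - K' * D) * (L - L')) = ((1 + C) * (K - K')) * (1 + X)"
    unfolding dL by (simp add: mult_ac)
  then have "E * (L - L') = 0"
    unfolding dK E_def by (simp add: algebra_simps)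
  moreover have "K' $ 0 = 0"
    using eqs(6) C by (metis fps_mult_nth_0 mult_zero_left)
  then have "E $ 0 = 1"
    using C by (simp add: E_def)
  then have "E \<noteq> 0" by auto
  ultimately show "L = L'" by simp
  with dX show "X = X'" by simp
qed

section \<open>Decomposing Rota-Baxter words\<close>

definition may_follow :: "rb_symbol \<Rightarrow> rb_symbol \<Rightarrow> bool" where
  "may_follow x y \<longleftrightarrow> \<not> (is_right x \<and> is_left y) \<and> \<not> (is_left x \<and> is_right y)"

lemma successively_iff_nth:
  "successively P xs \<longleftrightarrow> (\<forall>k. Suc k < length xs \<longrightarrow> P (xs ! k) (xs ! Suc k))"
proof (induction xs)
  case (Cons x xs)
  then show ?case
    by (cases xs) (auto simp: less_Suc_eq_0_disj)
qed simp

text \<open>Membership in terms of conditions that are compatible with concatenation and wrapping.\<close>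

lemma rb_words_iff:
  "w \<in> rb_words p q u v \<longleftrightarrow>
     set w \<subseteq> Gen ` {1..q} \<union> LBr ` {1..p} \<union> RBr ` {1..p} \<and> balanced w \<and>
     successively may_follow w \<and>
     (\<forall>i\<in>{1..p}. \<forall>n. chain_length i w n \<longrightarrow> enat n \<le> u i) \<and>
     (\<forall>j\<in>{1..q}. \<forall>l. sublist (replicate l (Gen j)) w \<longrightarrow> enat l \<le> v j)"
  by (auto simp: rb_words_def rb_word_def successively_iff_nth may_follow_def
      operator_runs_bounded_iff runs_bounded_iff)

definition nonempty_colorings :: "nat \<Rightarrow> (nat \<Rightarrow> enat) \<Rightarrow> nat list set" where
  "nonempty_colorings q v = {c. c \<noteq> [] \<and> c \<in> colorings (length c) q v}"

lemma nonempty_colorings_iff: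
  "c \<in> nonempty_colorings q v \<longleftrightarrow> c \<noteq> [] \<and> set c \<subseteq> {1..q} \<and>
     (\<forall>j\<in>{1..q}. \<forall>l. sublist (replicate l j) c \<longrightarrow> enat l \<le> v j)"
  by (auto simp: nonempty_colorings_def colorings_def runs_bounded_iff)

text \<open>A seam with a generator on exactly one side cannot put a right bracket next to a left
  bracket, and it joins no two generators; chains of operators do not cross the end of a
  balanced factor anyway.  So no condition looks across the seam.\<close>

lemma rb_words_append_iff:
  assumes "balanced a" "balanced b"
    and "a \<noteq> [] \<Longrightarrow> b \<noteq> [] \<Longrightarrow> is_gen (last a) \<noteq> is_gen (hd b)"
  shows "a @ b \<in> rb_words p q u v \<longleftrightarrow> a \<in> rb_words p q u v \<and> b \<in> rb_words p q u v"
proof -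
  have "successively may_follow (a @ b) \<longleftrightarrow> successively may_follow a \<and> successively may_follow b"
    using assms(3) balanced_last[OF assms(1)]
    by (auto simp: successively_append_iff may_follow_def is_gen_def is_right_def is_left_def)
  moreover have "sublist (replicate l (Gen j)) (a @ b) \<longleftrightarrow>
      sublist (replicate l (Gen j)) a \<or> sublist (replicate l (Gen j)) b" for l j
    using assms(3) by (intro sublist_replicate_append_iff) auto
  moreover have "balanced (a @ b)" by (rule balanced_append) fact+
  ultimately show ?thesis
    using assms(1,2) by (auto simp: rb_words_iff chain_length_append_iff)
qed

lemma no_chain_in_generators:
  assumes "chain_length i (map Gen c) n"
  shows "n = 0"
proof (rule ccontr)
  assume "n \<noteq> 0"
  with assms obtain k l where "matched_pair (map Gen c) i k l"
    by (auto simp: chain_length_def operator_chain_def)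
  then show False by (auto simp: matched_pair_def)
qed

lemma generators_in_rb_words_iff:
  "c \<noteq> [] \<Longrightarrow> map Gen c \<in> rb_words p q u v \<longleftrightarrow> c \<in> nonempty_colorings q v"
proof -
  have "successively may_follow (map Gen c)"
    by (auto simp: successively_iff_nth may_follow_def)
  moreover have "inj Gen" by (auto simp: inj_def)
  ultimately show "c \<noteq> [] \<Longrightarrow> ?thesis"
    by (auto simp: rb_words_iff nonempty_colorings_iff balanced_map_Gen
        sublist_replicate_map_iff dest!: no_chain_in_generators simp flip: zero_enat_def)
qed

text \<open>The bounds on operator runs split into bounds on the layers, which say that the subscripts
  form a coloring, and bounds inside the content.\<close>

lemma wrap_in_rb_words_iff:
  assumes "balanced m" "\<not> enclosed m" "m \<noteq> []" "c \<noteq> []"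
  shows "wrap c m \<in> rb_words p q u v \<longleftrightarrow> c \<in> nonempty_colorings p u \<and> m \<in> rb_words p q u v"
proof -
  have "successively may_follow (map LBr c)" "successively may_follow (map RBr (rev c))"
    by (auto simp: successively_iff_nth may_follow_def)
  moreover have "is_left (last (map LBr c))" "is_right (hd (map RBr (rev c)))"
    using assms(4) by (simp_all add: last_map hd_map)
  ultimately have "successively may_follow (wrap c m) \<longleftrightarrow> successively may_follow m"
    using assms(3,4) balanced_hd[OF assms(1,3)] balanced_last[OF assms(1,3)]
    by (auto simp: wrap_def successively_append_iff may_follow_def is_left_def is_right_def)
  moreover have "sublist (replicate l (Gen j)) (wrap c m) \<longleftrightarrow> sublist (replicate l (Gen j)) m" for l j
  proof -
    have no_gen: "sublist (replicate l (Gen j)) xs \<longleftrightarrow> l = 0" if "Gen j \<notin> set xs" for xs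
      using that by (cases l) (auto dest: set_mono_sublist)
    have "sublist (replicate l (Gen j)) (wrap c m) \<longleftrightarrow> sublist (replicate l (Gen j)) (map LBr c)
        \<or> sublist (replicate l (Gen j)) (m @ map RBr (rev c))"
      unfolding wrap_def using assms(4)
      by (intro sublist_replicate_append_iff) (auto simp: last_map)
    moreover have "sublist (replicate l (Gen j)) (m @ map RBr (rev c)) \<longleftrightarrow>
        sublist (replicate l (Gen j)) m \<or> sublist (replicate l (Gen j)) (map RBr (rev c))"
      using assms(4) by (intro sublist_replicate_append_iff) (auto simp: hd_map)
    moreover have "Gen j \<notin> set (map LBr c)" "Gen j \<notin> set (map RBr (rev c))" by auto
    ultimately show ?thesis using no_gen by auto
  qed
  moreover have "set (wrap c m) \<subseteq> Gen ` {1..q} \<union> LBr ` {1..p} \<union> RBr ` {1..p} \<longleftrightarrow>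
      set c \<subseteq> {1..p} \<and> set m \<subseteq> Gen ` {1..q} \<union> LBr ` {1..p} \<union> RBr ` {1..p}"
    by (auto simp: wrap_def)
  ultimately show ?thesis
    using assms
    by (auto simp: rb_words_iff nonempty_colorings_iff balanced_wrap chain_length_wrap_iff)
qed

lemma wrap_empty_not_rb_word: "c \<noteq> [] \<Longrightarrow> wrap c [] \<notin> rb_words p q u v"
  by (auto simp: rb_words_iff wrap_def successively_append_iff may_follow_def last_map hd_map)

definition gen_words :: "nat \<Rightarrow> nat \<Rightarrow> (nat \<Rightarrow> enat) \<Rightarrow> (nat \<Rightarrow> enat) \<Rightarrow> rb_symbol list set" where
  "gen_words p q u v = {w \<in> rb_words p q u v. w \<noteq> [] \<and> is_gen (hd w)}"

definition bracket_words :: "nat \<Rightarrow> nat \<Rightarrow> (nat \<Rightarrow> enat) \<Rightarrow> (nat \<Rightarrow> enat) \<Rightarrow> rb_symbol list set" where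
  "bracket_words p q u v = {w \<in> rb_words p q u v. w \<noteq> [] \<and> is_left (hd w)}"

definition enclosed_words :: "nat \<Rightarrow> nat \<Rightarrow> (nat \<Rightarrow> enat) \<Rightarrow> (nat \<Rightarrow> enat) \<Rightarrow> rb_symbol list set" where
  "enclosed_words p q u v = {w \<in> rb_words p q u v. enclosed w}"

text \<open>The possible contents of a maximal nest of brackets.\<close>

definition core_words :: "nat \<Rightarrow> nat \<Rightarrow> (nat \<Rightarrow> enat) \<Rightarrow> (nat \<Rightarrow> enat) \<Rightarrow> rb_symbol list set" where
  "core_words p q u v = {w \<in> rb_words p q u v. w \<noteq> [] \<and> \<not> enclosed w}"

lemma Nil_in_rb_words: "[] \<in> rb_words p q u v"
  by (auto simp: rb_words_def rb_word_def balanced_empty is_operator_run_def matched_pair_def is_run_def)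

lemma rb_words_balanced: "w \<in> rb_words p q u v \<Longrightarrow> balanced w"
  by (simp add: rb_words_def rb_word_def)

lemma rb_words_partition:
  "rb_words p q u v = {[]} \<union> (gen_words p q u v \<union> bracket_words p q u v)"
proof -
  have "is_gen (hd w) \<or> is_left (hd w)" if "w \<in> rb_words p q u v" "w \<noteq> []" for w
    using balanced_hd[OF rb_words_balanced[OF that(1)] that(2)] by (cases "hd w") auto
  then show ?thesis
    using Nil_in_rb_words by (auto simp: gen_words_def bracket_words_def)
qed

text \<open>The first block of generators is taken to be as long as possible, so what follows is empty
  or starts with a left bracket.\<close>

lemma gen_words_eq:
  "gen_words p q u v =
     (\<lambda>(c, w). map Gen c @ w) ` (nonempty_colorings q v \<times> ({[]} \<union> bracket_words p q u v))"
    (is "_ = ?f ` ?P")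
proof (intro equalityI subsetI)
  have iff: "map Gen c @ w \<in> rb_words p q u v \<longleftrightarrow>
      c \<in> nonempty_colorings q v \<and> w \<in> rb_words p q u v"
    if "c \<noteq> []" "balanced w" "w = [] \<or> is_left (hd w)" for c w
  proof -
    have "w \<noteq> [] \<Longrightarrow> is_gen (last (map Gen c)) \<noteq> is_gen (hd w)"
      using that by (auto simp: last_map is_left_def)
    then show ?thesis
      using that(1,2) by (simp add: rb_words_append_iff balanced_map_Gen generators_in_rb_words_iff)
  qed
  {
    fix w assume "w \<in> gen_words p q u v"
    then have w: "w \<in> rb_words p q u v" "w \<noteq> []" "is_gen (hd w)"
      by (auto simp: gen_words_def)
    define b where "b = dropWhile is_gen w"
    define c where "c = map (\<lambda>x. case x of Gen j \<Rightarrow> j) (takeWhile is_gen w)"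
    have "map Gen c = takeWhile is_gen w"
      unfolding c_def map_map
      by (rule map_idI) (auto simp: is_gen_def dest!: set_takeWhileD)
    then have split: "w = map Gen c @ b" by (simp add: b_def)
    have "c \<noteq> []" using w(2,3) by (cases w) (auto simp: c_def)
    have bal: "balanced b"
      using rb_words_balanced[OF w(1)] unfolding split by (simp add: balanced_map_Gen_append_iff)
    have "b = [] \<or> is_left (hd b)"
      using balanced_hd[OF bal] hd_dropWhile[of is_gen w] by (cases "hd b") (auto simp: b_def)
    moreover from this have "c \<in> nonempty_colorings q v \<and> b \<in> rb_words p q u v"
      using iff[OF \<open>c \<noteq> []\<close> bal] w(1) unfolding split by blast
    ultimately have "(c, b) \<in> ?P" by (auto simp: bracket_words_def)
    then show "w \<in> ?f ` ?P" using split by (intro image_eqI[of _ _ "(c, b)"]) auto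
  next
    fix w assume "w \<in> ?f ` ?P"
    then obtain c b where cb: "c \<in> nonempty_colorings q v" "b \<in> {[]} \<union> bracket_words p q u v"
      and split: "w = map Gen c @ b" by auto
    have "c \<noteq> []" using cb(1) by (simp add: nonempty_colorings_def)
    moreover have b: "b \<in> rb_words p q u v" "b = [] \<or> is_left (hd b)"
      using cb(2) Nil_in_rb_words by (auto simp: bracket_words_def)
    ultimately have "w \<in> rb_words p q u v"
      unfolding split using iff cb(1) rb_words_balanced by blast
    then show "w \<in> gen_words p q u v"
      using \<open>c \<noteq> []\<close> by (auto simp: gen_words_def split hd_append hd_map)
  }
qed

lemma inj_on_gen_words:
  "inj_on (\<lambda>(c, w). map Gen c @ w) (A \<times> ({[]} \<union> bracket_words p q u v))"
proof (rule inj_onI, clarify)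
  fix c w c' w'
  assume w: "w \<in> {[]} \<union> bracket_words p q u v" "w' \<in> {[]} \<union> bracket_words p q u v"
    and eq: "map Gen c @ w = map Gen c' @ w'"
  have tw: "takeWhile is_gen (map Gen c @ w) = map Gen c"
    if "w \<in> {[]} \<union> bracket_words p q u v" for c w
  proof -
    have "takeWhile is_gen w = []"
      using that by (cases w) (auto simp: bracket_words_def is_left_def)
    then show ?thesis by (subst takeWhile_append2) auto
  qed
  have "map Gen c = map Gen c'"
    using tw[OF w(1)] tw[OF w(2)] eq by metis
  moreover have "inj Gen" by (auto simp: inj_def)
  ultimately show "c = c' \<and> w = w'" using eq by (auto dest: inj_mapD)
qed

text \<open>The first factor ends at the partner of the first left bracket.  What follows cannot start
  with a left bracket, as this would come directly after a right bracket.\<close>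

lemma bracket_words_eq:
  "bracket_words p q u v =
     (\<lambda>(a, w). a @ w) ` (enclosed_words p q u v \<times> ({[]} \<union> gen_words p q u v))"
    (is "_ = ?f ` ?P")
proof (intro equalityI subsetI)
  fix w assume "w \<in> bracket_words p q u v"
  then have w: "w \<in> rb_words p q u v" "w \<noteq> []" "is_left (hd w)"
    by (auto simp: bracket_words_def)
  from rb_words_balanced[OF w(1)] obtain i a b
    where "w = LBr i # a @ RBr i # b" and ab: "balanced a" "balanced b"
    by (rule balanced_cases) (use w(2,3) in auto)
  define e where "e = LBr i # a @ [RBr i]"
  have split: "w = e @ b" by (simp add: e_def \<open>w = _\<close>)
  have enc: "enclosed e" using ab(1) by (auto simp: e_def enclosed_def)
  have "successively may_follow w" using w(1) by (simp add: rb_words_iff)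
  then have b: "b = [] \<or> is_gen (hd b)"
    using balanced_hd[OF ab(2)]
    by (cases "hd b") (auto simp: split e_def successively_append_iff successively_Cons may_follow_def)
  have "e \<in> rb_words p q u v \<and> b \<in> rb_words p q u v"
  proof (subst rb_words_append_iff[symmetric])
    show "balanced e" unfolding e_def by (rule balanced_bracket) fact
    show "is_gen (last e) \<noteq> is_gen (hd b)" if "b \<noteq> []" using b that by (simp add: e_def)
  qed (use w(1) split ab(2) in auto)
  with b enc have "(e, b) \<in> ?P" by (auto simp: enclosed_words_def gen_words_def)
  then show "w \<in> ?f ` ?P" using split by (intro image_eqI[of _ _ "(e, b)"]) auto
next
  fix w assume "w \<in> ?f ` ?P"
  then obtain e b where eb: "e \<in> enclosed_words p q u v" "b \<in> {[]} \<union> gen_words p q u v"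
    and split: "w = e @ b" by auto
  then obtain i a where e: "e = LBr i # a @ [RBr i]" "e \<in> rb_words p q u v"
    by (auto simp: enclosed_words_def enclosed_def)
  have b: "b \<in> rb_words p q u v" "b = [] \<or> is_gen (hd b)"
    using eb(2) Nil_in_rb_words by (auto simp: gen_words_def)
  have "w \<in> rb_words p q u v"
    unfolding split
    by (subst rb_words_append_iff) (use e b rb_words_balanced in auto)
  then show "w \<in> bracket_words p q u v"
    by (auto simp: bracket_words_def split e)
qed

lemma inj_on_bracket_words: "inj_on (\<lambda>(a, w). a @ w) (enclosed_words p q u v \<times> B)"
proof (rule inj_onI, clarify)
  fix a w a' w'
  assume "a \<in> enclosed_words p q u v" "a' \<in> enclosed_words p q u v" and eq: "a @ w = a' @ w'"
  then obtain i b i' b' where b: "balanced b" "a = LBr i # b @ [RBr i]"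
      and b': "balanced b'" "a' = LBr i' # b' @ [RBr i']"
    by (auto simp: enclosed_words_def enclosed_def)
  then have "b @ RBr i # w = b' @ RBr i' # w'" using eq by auto
  from balanced_prefix_unique[OF b(1) b'(1) this] show "a = a' \<and> w = w'"
    by (simp add: b(2) b'(2))
qed

text \<open>The content of a nest is nonempty, as otherwise the innermost left bracket would be followed
  directly by a right bracket.\<close>

lemma enclosed_words_eq:
  "enclosed_words p q u v = (\<lambda>(c, m). wrap c m) ` (nonempty_colorings p u \<times> core_words p q u v)"
    (is "_ = ?f ` ?P")
proof (intro equalityI subsetI)
  fix w assume "w \<in> enclosed_words p q u v"
  then have w: "w \<in> rb_words p q u v" "enclosed w" by (auto simp: enclosed_words_def)
  obtain c m where cm: "c \<noteq> []" "balanced m" "\<not> enclosed m" "w = wrap c m"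
    using enclosed_obtain_wrap[OF w(2)] by blast
  have "m \<noteq> []" using w(1) cm(1,4) wrap_empty_not_rb_word by metis
  then have "(c, m) \<in> ?P"
    using w(1) cm wrap_in_rb_words_iff[OF cm(2,3) _ cm(1)] by (auto simp: core_words_def)
  then show "w \<in> ?f ` ?P" using cm(4) by (intro image_eqI[of _ _ "(c, m)"]) auto
next
  fix w assume "w \<in> ?f ` ?P"
  then obtain c m where cm: "c \<in> nonempty_colorings p u" "m \<in> core_words p q u v" "w = wrap c m"
    by auto
  then have "c \<noteq> []" "balanced m" "m \<in> rb_words p q u v" "m \<noteq> []" "\<not> enclosed m"
    by (auto simp: nonempty_colorings_def core_words_def rb_words_balanced)
  then show "w \<in> enclosed_words p q u v"
    using cm by (auto simp: enclosed_words_def enclosed_wrap wrap_in_rb_words_iff)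
qed

lemma inj_on_enclosed_words: "inj_on (\<lambda>(c, m). wrap c m) (A \<times> core_words p q u v)"
proof (rule inj_onI, clarify)
  fix c m c' m'
  assume "m \<in> core_words p q u v" "m' \<in> core_words p q u v" "wrap c m = wrap c' m'"
  then show "c = c' \<and> m = m'"
    by (intro wrap_inject) (auto simp: core_words_def rb_words_balanced)
qed

section \<open>Functional equations and the substitution formula\<close>

definition lefts :: "rb_symbol list \<Rightarrow> nat" where
  "lefts w = length (filter is_left w)"

definition word_gf :: "rb_symbol list set \<Rightarrow> int fps fps" where
  "word_gf = weight_gf lefts arity"

lemma lefts_simps [simp]: "lefts (a @ b) = lefts a + lefts b" "lefts [] = 0"
    "lefts (map Gen c) = 0" "lefts (wrap c m) = length c + lefts m"
  and arity_simps [simp]: "arity (a @ b) = arity a + arity b" "arity [] = 0"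
    "arity (map Gen c) = length c" "arity (wrap c m) = arity m"
  by (auto simp: lefts_def arity_def wrap_def filter_map comp_def)

lemma rb_gf_eq_word_gf: "rb_gf p q u v = word_gf (rb_words p q u v)"
proof -
  have "{w \<in> rb_words p q u v. degree w = n \<and> arity w = m} =
      {w \<in> rb_words p q u v. lefts w = n \<and> arity w = m}" for n m
    using degree_eq_lefts rb_words_balanced by (auto simp: lefts_def)
  then show ?thesis
    by (simp add: rb_gf_def word_gf_def weight_gf_def rb_count_def)
qed

lemma finite_levels_rb_words: "finite_levels lefts arity (rb_words p q u v)"
  unfolding finite_levels_def
proof (intro allI)
  fix n m :: nat
  have "{w \<in> rb_words p q u v. lefts w = n \<and> arity w = m} =
      {w \<in> rb_words p q u v. degree w = n \<and> arity w = m}"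
    using degree_eq_lefts rb_words_balanced by (auto simp: lefts_def)
  then show "finite {w \<in> rb_words p q u v. lefts w = n \<and> arity w = m}"
    by (simp add: finite_rb_words)
qed

lemma nonempty_colorings_level:
  "{c \<in> nonempty_colorings q v. length c = n} = (if n = 0 then {} else colorings n q v)"
  by (auto simp: nonempty_colorings_def colorings_def)

lemma finite_levels_colorings:
  "finite_levels length (\<lambda>_. 0) (nonempty_colorings q v)"
  "finite_levels (\<lambda>_. 0) length (nonempty_colorings q v)"
proof -
  have "finite {c \<in> nonempty_colorings q v. length c = n}" for n
    by (simp add: nonempty_colorings_level finite_colorings)
  then show "finite_levels length (\<lambda>_. 0) (nonempty_colorings q v)"
    "finite_levels (\<lambda>_. 0) length (nonempty_colorings q v)"
    unfolding finite_levels_def by (auto intro: rev_finite_subset)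
qed

lemma weight_gf_colorings_z:
  "weight_gf length (\<lambda>_. 0) (nonempty_colorings q v) = in_z (coloring_gf q v)"
proof (intro fps_ext)
  fix n m :: nat
  have "{c \<in> nonempty_colorings q v. length c = n \<and> 0 = m} =
      (if n = 0 \<or> m \<noteq> 0 then {} else colorings n q v)"
    by (auto simp: nonempty_colorings_def colorings_def)
  then show "weight_gf length (\<lambda>_. 0) (nonempty_colorings q v) $ n $ m = in_z (coloring_gf q v) $ n $ m"
    by (simp add: weight_gf_def in_z_def coloring_gf_def coloring_count_def)
qed

lemma weight_gf_colorings_t:
  "weight_gf (\<lambda>_. 0) length (nonempty_colorings q v) = fps_const (coloring_gf q v)"
proof (intro fps_ext)
  fix n m :: nat
  have "{c \<in> nonempty_colorings q v. 0 = n \<and> length c = m} =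
      (if m = 0 \<or> n \<noteq> 0 then {} else colorings m q v)"
    by (auto simp: nonempty_colorings_def colorings_def)
  then show "weight_gf (\<lambda>_. 0) length (nonempty_colorings q v) $ n $ m =
      fps_const (coloring_gf q v) $ n $ m"
    by (simp add: weight_gf_def coloring_gf_def coloring_count_def)
qed

text \<open>The factorisations of the three classes of words, in terms of series.  In the last equation,
  \<open>X + L - K\<close> arises because the nonempty words are partitioned into the enclosed
  words and the contents of nests, and also into the words that start with a generator
  and those that start with a left bracket.\<close>

lemma rb_words_block_equations:
  defines "X \<equiv> \<lambda>p q u v. word_gf (gen_words p q u v)"
    and "L \<equiv> \<lambda>p q u v. word_gf (bracket_words p q u v)"
    and "K \<equiv> \<lambda>p q u v. word_gf (enclosed_words p q u v)"
  shows "block_equations (in_z (coloring_gf p u)) (fps_const (coloring_gf q v))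
           (X p q u v) (L p q u v) (K p q u v)"
    and "rb_gf p q u v = 1 + (X p q u v + L p q u v)"
proof -
  let ?G = "gen_words p q u v" and ?B = "bracket_words p q u v"
    and ?E = "enclosed_words p q u v" and ?M = "core_words p q u v"
  have fin: "finite_levels lefts arity A" if "A \<subseteq> rb_words p q u v" for A
    using finite_levels_rb_words that by (rule finite_levels_subset)
  have sub: "?G \<subseteq> rb_words p q u v" "?B \<subseteq> rb_words p q u v"
      "?E \<subseteq> rb_words p q u v" "?M \<subseteq> rb_words p q u v"
    by (auto simp: gen_words_def bracket_words_def enclosed_words_def core_words_def)
  have ne: "[] \<notin> ?G" "[] \<notin> ?B" "?G \<inter> ?B = {}"
    by (auto simp: gen_words_def bracket_words_def is_gen_def)
  have Un: "word_gf (A \<union> B) = word_gf A + word_gf B"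
    if "A \<subseteq> rb_words p q u v" "B \<subseteq> rb_words p q u v" "A \<inter> B = {}" for A B
    unfolding word_gf_def by (rule weight_gf_Un) (use that fin in auto)
  have one: "word_gf {[]} = 1"
    by (simp add: word_gf_def weight_gf_singleton)
  have insert_Nil: "word_gf ({[]} \<union> A) = 1 + word_gf A" "finite_levels lefts arity ({[]} \<union> A)"
    if "A \<subseteq> rb_words p q u v" "[] \<notin> A" for A
    using that Nil_in_rb_words by (auto simp: Un one intro!: fin simp del: Un_insert_left)
  have GB: "word_gf (?G \<union> ?B) = word_gf ?G + word_gf ?B"
    using sub ne by (intro Un) auto
  show "rb_gf p q u v = 1 + (X p q u v + L p q u v)"
    unfolding rb_gf_eq_word_gf X_def L_def
    by (subst rb_words_partition, subst insert_Nil(1)) (use sub ne GB in auto)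
  have "word_gf ?G = fps_const (coloring_gf q v) * (1 + word_gf ?B)"
    unfolding gen_words_eq insert_Nil(1)[OF sub(2) ne(2), symmetric]
      weight_gf_colorings_t[symmetric]
    unfolding word_gf_def
    by (rule weight_gf_times[OF inj_on_gen_words])
      (use finite_levels_colorings insert_Nil(2)[OF sub(2) ne(2)] in auto)
  moreover have "word_gf ?B = word_gf ?E * (1 + word_gf ?G)"
    unfolding bracket_words_eq insert_Nil(1)[OF sub(1) ne(1), symmetric]
    unfolding word_gf_def
    by (rule weight_gf_times[OF inj_on_bracket_words])
      (use fin[OF sub(3)] insert_Nil(2)[OF sub(1) ne(1)] in auto)
  moreover have "word_gf ?E = in_z (coloring_gf p u) * word_gf ?M"
    unfolding enclosed_words_eq weight_gf_colorings_z[symmetric]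
    unfolding word_gf_def
    by (rule weight_gf_times[OF inj_on_enclosed_words])
      (use finite_levels_colorings fin[OF sub(4)] in auto)
  moreover have "word_gf ?M + word_gf ?E = word_gf (?G \<union> ?B)"
  proof (subst Un[symmetric])
    have "?M \<union> ?E = {w \<in> rb_words p q u v. w \<noteq> []}"
      by (auto simp: core_words_def enclosed_words_def enclosed_def)
    also have "\<dots> = ?G \<union> ?B" using rb_words_partition ne by blast
    finally show "word_gf (?M \<union> ?E) = word_gf (?G \<union> ?B)" by simp
  qed (use sub in \<open>auto simp: core_words_def enclosed_words_def\<close>)
  then have "word_gf ?M = word_gf ?G + word_gf ?B - word_gf ?E"
    unfolding GB by (simp add: algebra_simps)
  ultimately show "block_equations (in_z (coloring_gf p u)) (fps_const (coloring_gf q v))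
           (X p q u v) (L p q u v) (K p q u v)"
    unfolding block_equations_def X_def L_def K_def by metis
qed

text \<open>With a single color, a coloring is one single run, so the bound \<open>1\<close> leaves only one
  object.\<close>

lemma coloring_gf_trivial: "coloring_gf 1 (\<lambda>_. 1) = fps_X"
proof -
  have c: "nonempty_colorings 1 (\<lambda>_. 1) = {[1]}"
  proof (intro equalityI subsetI)
    fix c assume c: "c \<in> nonempty_colorings 1 (\<lambda>_. 1)"
    then have "set c \<subseteq> {1}" by (simp add: nonempty_colorings_iff)
    then have "replicate (length c) 1 = c" by (intro replicate_length_same) auto
    then have "sublist (replicate (length c) 1) c" by simp
    with c have "enat (length c) \<le> 1" "c \<noteq> []" by (auto simp: nonempty_colorings_iff)
    then have "length c = 1" by (cases c) (auto simp: one_enat_def)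
    with \<open>set c \<subseteq> {1}\<close> show "c \<in> {[1]}" by (auto simp: length_Suc_conv)
  qed (auto simp: nonempty_colorings_iff one_enat_def dest: sublist_length_le)
  have "coloring_gf 1 (\<lambda>_. 1) $ n = int (card {x \<in> {[1 :: nat]}. length x = n})" for n
    unfolding c[symmetric] nonempty_colorings_level by (simp add: coloring_gf_def coloring_count_def)
  moreover have "{x \<in> {[1 :: nat]}. length x = n} = (if n = 1 then {[1]} else {})" for n
    by auto
  ultimately show ?thesis by (intro fps_ext) (simp add: fps_X_def)
qed

theorem theorem5p5:
  fixes p q :: nat and u v :: "nat \<Rightarrow> enat"
  assumes "p \<ge> 1" and "q \<ge> 1"
    and "\<forall>i\<in>{1..p}. u i \<ge> 1" and "\<forall>j\<in>{1..q}. v j \<ge> 1"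
  shows "rb_gf p q u v =
         fps_subst2 (rb_gf 1 1 (\<lambda>_. 1) (\<lambda>_. 1)) (coloring_gf p u) (coloring_gf q v)"
proof -
  let ?C = "coloring_gf p u" and ?D = "coloring_gf q v" and ?one = "\<lambda>_::nat. 1::enat"
  define S where "S F = fps_subst2 F ?C ?D" for F
  have CD: "?C $ 0 = 0" "?D $ 0 = 0" by (simp_all add: coloring_gf_def)
  note hom = fps_subst2_add[OF CD, folded S_def] fps_subst2_diff[OF CD, folded S_def]
    fps_subst2_mult[OF CD, folded S_def] fps_subst2_1[OF CD, folded S_def]
    fps_subst2_z[OF CD, folded S_def] fps_subst2_t[OF CD, folded S_def]
  have block_equations_hom: "block_equations (in_z ?C) (fps_const ?D) (S X) (S L) (S K)"
    if "block_equations fps_X (fps_const fps_X) X L K" for X L K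
    using that unfolding block_equations_def by (metis hom)
  let ?X = "word_gf (gen_words 1 1 ?one ?one)" and ?L = "word_gf (bracket_words 1 1 ?one ?one)"
    and ?K = "word_gf (enclosed_words 1 1 ?one ?one)"
  have "block_equations (in_z ?C) (fps_const ?D) (S ?X) (S ?L) (S ?K)"
    using rb_words_block_equations(1)[of 1 ?one 1 ?one]
    by (intro block_equations_hom) (simp only: coloring_gf_trivial in_z_X)
  moreover have "in_z ?C $ 0 = 0" using CD(1) by (simp add: in_z_def)
  ultimately have "word_gf (gen_words p q u v) = S ?X" "word_gf (bracket_words p q u v) = S ?L"
    using block_equations_unique rb_words_block_equations(1) by metis+
  then show ?thesis
    unfolding rb_words_block_equations(2) by (simp add: hom flip: S_def)
qed

end
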